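(* There exists $\gamma'>0$ such that the following holds. Let $\delta(n,k)$ be an integer-valued function with $5\le \delta(n,k)\le C\,\frac{n^{\gamma'}}{k}$ for some constant $C$ and all $n,k$. For each $n$ let $G_n$ be a connected simple graph on $k_n$ vertices with minimum degree $\delta(n,k_n)$. Then the probability that a random $n$-lift of $G_n$ is $\delta(n,k_n)$-connected tends to $1$ as $n\to\infty$.
   Context: A random $n$-lift $\tilde G$ of a graph $G$: orient the edges of $G$ arbitrarily and assign to each edge $e$ a permutation $\pi_e\in\mathcal{S}_n$, independently and uniformly at random; $\tilde G$ has vertex set $V(G)\times\{1,\dots,n\}$, with $(u,i)$ joined to $(v,j)$ iff there is an edge $e$ of $G$ oriented from $u$ to $v$ with $\pi_e(i)=j$. Here "$\delta$-connected" means $\delta$-edge-connected: for every nonempty proper subset $S$ of the vertex set, at least $\delta$ edges have exactly one endpoint in $S$. *)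

theory Defs
  imports
    "HOL-Probability.Probability"
    "HOL-Probability.Product_PMF"
    "HOL-Combinatorics.Permutations"
    "Graph_Theory.Digraph_Component"
begin

text \<open>
  Finite simple graphs are represented by the locale \<open>pair_graph\<close>: finite, symmetric, loop-free
  digraphs without parallel arcs, so that an undirected edge \<open>uv\<close> is the pair of arcs
  \<open>(u, v)\<close> and \<open>(v, u)\<close>. Under this representation the degree of a vertex is its out-degree.
\<close>

definition min_degree :: "'a pair_pre_digraph \<Rightarrow> nat" where
  "min_degree G = Min (out_degree (with_proj G) ` pverts G)"

definition uedges :: "'a pair_pre_digraph \<Rightarrow> 'a set set" where
  "uedges G = {{u, v} | u v. (u, v) \<in> parcs G}"

definition edge_connected :: "nat \<Rightarrow> 'a pair_pre_digraph \<Rightarrow> bool" where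
  "edge_connected d G \<longleftrightarrow>
     (\<forall>S. S \<noteq> {} \<and> S \<subset> pverts G \<longrightarrow> d \<le> card {e \<in> uedges G. card (e \<inter> S) = 1})"

text \<open>An orientation picks exactly one of the two arcs of every undirected edge.\<close>

definition orientation :: "'a pair_pre_digraph \<Rightarrow> 'a rel \<Rightarrow> bool" where
  "orientation G D \<longleftrightarrow> D \<union> D\<inverse> = parcs G \<and> D \<inter> D\<inverse> = {}"

definition lift_arcs ::
  "nat \<Rightarrow> 'a rel \<Rightarrow> ('a \<times> 'a \<Rightarrow> nat \<Rightarrow> nat) \<Rightarrow> ('a \<times> nat) rel" where
  "lift_arcs n D \<pi> =
     {((u, i), (v, j)) | u v i j. (u, v) \<in> D \<and> i \<in> {1..n} \<and> j \<in> {1..n} \<and> \<pi> (u, v) i = j}"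

definition lift_graph ::
  "nat \<Rightarrow> 'a pair_pre_digraph \<Rightarrow> 'a rel \<Rightarrow> ('a \<times> 'a \<Rightarrow> nat \<Rightarrow> nat) \<Rightarrow> ('a \<times> nat) pair_pre_digraph" where
  "lift_graph n G D \<pi> =
     \<lparr> pverts = pverts G \<times> {1..n}, parcs = lift_arcs n D \<pi> \<union> (lift_arcs n D \<pi>)\<inverse> \<rparr>"

text \<open>
  The product distribution makes the permutations of the oriented edges independent and uniform;
  the value \<open>id\<close> is only the default outside \<open>D\<close>, where it is never used.
\<close>

definition random_lift ::
  "nat \<Rightarrow> 'a pair_pre_digraph \<Rightarrow> 'a rel \<Rightarrow> ('a \<times> nat) pair_pre_digraph pmf" where
  "random_lift n G D =
     map_pmf (lift_graph n G D) (Pi_pmf D id (\<lambda>_. pmf_of_set {p. p permutes {1..n}}))"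

end

theory Submission
  imports Defs "HOL-Real_Asymp.Real_Asymp"
begin

text \<open>
  Write \<open>w = \<delta> k\<close>, so \<open>w\<close> is at most \<open>C n^\<gamma>'\<close>. Suppose a vertex set \<open>S\<close> of the lift has a cut
  smaller than \<open>\<delta>\<close>. As the base graph is connected, any two fibres \<open>S_v\<close> differ in size by less than
  \<open>\<delta>\<close>, and after complementing we may assume that a fixed fibre is at most half full.

  If that fibre has fewer than \<open>10 \<delta>\<close> elements, then \<open>S\<close> has \<open>s \<le> 11 w\<close> elements. Counting degrees,
  and using that the lift is simple and \<open>\<delta> \<ge> 5\<close>, \<open>S\<close> spans at least \<open>2 s\<close> edges. A union
  bound over \<open>S\<close> and \<open>2 s\<close> pairs inside it gives \<open>(k n)^s (s^2)^(2 s) (2/n)^(2 s)\<close>, which is small.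

  Otherwise let \<open>a\<close> be the size of that fibre. There are \<open>n^O(w) (n choose a)^k\<close> families of fibres, and
  each edge of the base is almost respected with probability \<open>n^O(\<delta>) / (n choose a)\<close>. As there are at
  least \<open>5 k / 2\<close> edges and \<open>(n choose a) \<ge> (n + 1)^(5 \<delta>)\<close>, the union bound is again small.
\<close>

section \<open>Binomial coefficients with nearby lower indices\<close>

lemma choose_Suc_le: "(n choose Suc b) \<le> n * (n choose b)"
proof -
  have "(n choose Suc b) \<le> Suc b * (n choose Suc b)" by simp
  also have "\<dots> = (n - b) * (n choose b)" using binomial_absorb_comp[of n b] binomial_absorption[of b n] by simp
  also have "\<dots> \<le> n * (n choose b)" by simp
  finally show ?thesis .
qed

lemma choose_le_Suc:
  assumes "b < n"
  shows "(n choose b) \<le> n * (n choose Suc b)"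
proof -
  have "(n choose b) \<le> (n - b) * (n choose b)" using assms by simp
  also have "\<dots> = Suc b * (n choose Suc b)" using binomial_absorb_comp[of n b] binomial_absorption[of b n] by simp
  also have "\<dots> \<le> n * (n choose Suc b)" using assms by (intro mult_right_mono) auto
  finally show ?thesis .
qed

lemma choose_add_le: "(n choose (b + j)) \<le> n ^ j * (n choose b)"
proof (induction j)
  case (Suc j)
  have "(n choose (b + Suc j)) \<le> n * (n choose (b + j))" using choose_Suc_le[of n "b + j"] by simp
  also have "\<dots> \<le> n * (n ^ j * (n choose b))" using Suc by (rule mult_left_mono) simp
  finally show ?case by (simp add: mult.assoc)
qed simp

lemma choose_le_add: "b + j \<le> n \<Longrightarrow> (n choose b) \<le> n ^ j * (n choose (b + j))"
proof (induction j)
  case (Suc j)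
  have "(n choose b) \<le> n ^ j * (n choose (b + j))" using Suc by simp
  also have "\<dots> \<le> n ^ j * (n * (n choose Suc (b + j)))"
    using Suc.prems by (intro mult_left_mono choose_le_Suc) auto
  finally show ?case by (simp add: mult_ac)
qed simp

text \<open>Moving the lower index by one, in either direction, costs a factor of at most
  \<open>n\<close> inside the range. The base \<open>Suc n\<close> lets the exponent be raised from
  the actual distance to \<open>d\<close> even when \<open>n\<close> is zero.\<close>

lemma choose_near_le:
  assumes "a \<le> n" "b \<le> n" "a \<le> b + d" "b \<le> a + d"
  shows "(n choose b) \<le> Suc n ^ d * (n choose a)"
proof -
  obtain j where j: "j \<le> d" "(n choose b) \<le> n ^ j * (n choose a)"
  proof (cases "a \<le> b")
    case True then show ?thesis using that[of "b - a"] choose_add_le[of n a "b - a"] assms by auto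
  next
    case False then show ?thesis using that[of "a - b"] choose_le_add[of b "a - b" n] assms by auto
  qed
  have "n ^ j \<le> Suc n ^ j" by (rule power_mono) auto
  also have "\<dots> \<le> Suc n ^ d" using j(1) by (rule power_increasing) auto
  finally have "n ^ j * (n choose a) \<le> Suc n ^ d * (n choose a)" by (rule mult_right_mono) simp
  with j(2) show ?thesis by linarith
qed

section \<open>Events for a single uniform random permutation\<close>

lemma pow_mult_fact_le: "m \<le> n \<Longrightarrow> (n - m) ^ m * fact (n - m) \<le> (fact n :: nat)"
proof -
  have "(l :: nat) ^ m * fact l \<le> fact (l + m)" for l
  proof (induction m)
    case (Suc m)
    have "l ^ Suc m * fact l = l * (l ^ m * fact l)" by simp
    also have "\<dots> \<le> (l + Suc m) * fact (l + m)" using Suc by (intro mult_mono) auto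
    finally show ?case by simp
  qed simp
  from this[of "n - m"] show "m \<le> n \<Longrightarrow> ?thesis" by simp
qed

lemma permutes_nonempty_finite:
  assumes "finite A"
  shows "{p. p permutes A} \<noteq> {}" "finite {p. p permutes A}"
  using permutes_id[of A] finite_permutations[OF assms] by blast+

lemma measure_pmf_of_permutations:
  assumes "finite A"
  shows "measure_pmf.prob (pmf_of_set {p. p permutes A}) X
           = real (card {p. p permutes A \<and> p \<in> X}) / fact (card A)"
proof -
  have "{p. p permutes A} \<inter> X = {p. p permutes A \<and> p \<in> X}" by blast
  then show ?thesis
    by (simp only: measure_pmf_of_set[OF permutes_nonempty_finite[OF assms]]
        card_permutations[OF refl assms] of_nat_fact)
qed

lemma inj_on_inv_comp:
  assumes "q permutes A"
  shows "inj_on (\<lambda>p. inv q \<circ> p) X"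
proof (rule inj_onI)
  fix p r assume "inv q \<circ> p = inv q \<circ> r"
  then have "q \<circ> (inv q \<circ> p) = q \<circ> (inv q \<circ> r)" by simp
  then show "p = r" by (simp add: permutes_inverses(1)[OF assms] fun_eq_iff)
qed

lemma card_permutes_extending:
  assumes fin: "finite A" "finite M" and dom: "fst ` M \<subseteq> A"
  shows "card {p. p permutes A \<and> (\<forall>(i, j)\<in>M. p i = j)} \<le> fact (card A - card M)"
proof (cases "{p. p permutes A \<and> (\<forall>(i, j)\<in>M. p i = j)} = {}")
  case False
  then obtain q where q: "q permutes A" "\<forall>(i, j)\<in>M. q i = j" by blast
  have inj: "inj_on fst M" 
  proof (rule inj_onI)
    fix x y assume "x \<in> M" "y \<in> M" "fst x = fst y"
    moreover have "snd z = q (fst z)" if "z \<in> M" for z using q(2) that by auto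
    ultimately show "x = y" by (simp add: prod_eq_iff)
  qed
  let ?P = "{p. p permutes A \<and> (\<forall>(i, j)\<in>M. p i = j)}"
  have "card ?P \<le> card {r. r permutes (A - fst ` M)}"
  proof (rule card_inj_on_le[where f = "\<lambda>p. inv q \<circ> p"])
    show "inj_on (\<lambda>p. inv q \<circ> p) ?P"
      by (rule inj_on_inv_comp[OF q(1)])
    show "(\<lambda>p. inv q \<circ> p) ` ?P \<subseteq> {r. r permutes (A - fst ` M)}"
    proof clarify
      fix p assume p: "p permutes A" "\<forall>(i, j)\<in>M. p i = j"
      have "inv q \<circ> p permutes A" using p(1) q(1) by (simp add: permutes_compose permutes_inv)
      moreover have "(inv q \<circ> p) i = i" if i: "i \<in> fst ` M" for i
      proof -
        obtain j where "(i, j) \<in> M" using i by auto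
        then have "p i = q i" using p(2) q(2) by auto
        then show ?thesis using permutes_inverses(2)[OF q(1)] by simp
      qed
      ultimately show "inv q \<circ> p permutes (A - fst ` M)"
        by (rule permutes_superset) blast
    qed
    show "finite {r. r permutes (A - fst ` M)}" using fin by (simp add: finite_permutations)
  qed
  also have "\<dots> = fact (card A - card M)"
    using fin dom inj by (subst card_permutations[OF refl]) (auto simp: card_Diff_subset card_image)
  finally show ?thesis .
next
  case True
  show ?thesis unfolding True by simp
qed

text \<open>The bound uses a common \<open>t\<close> instead of \<open>card M\<close> in the
  denominator, so that factors coming from different arcs can be multiplied together.\<close>

lemma prob_permutes_extending:
  assumes fin: "finite A" "finite M" and dom: "fst ` M \<subseteq> A" and t: "card M \<le> t" "t < card A"
  shows "measure_pmf.prob (pmf_of_set {p. p permutes A}) {p. \<forall>(i, j)\<in>M. p i = j}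
           \<le> (1 / real (card A - t)) ^ card M"
proof -
  let ?n = "card A" and ?m = "card M"
  have "measure_pmf.prob (pmf_of_set {p. p permutes A}) {p. \<forall>(i, j)\<in>M. p i = j}
        = real (card {p. p permutes A \<and> (\<forall>(i, j)\<in>M. p i = j)}) / fact ?n"
    by (simp only: measure_pmf_of_permutations[OF fin(1)] mem_Collect_eq)
  also have "\<dots> \<le> fact (?n - ?m) / fact ?n"
    using of_nat_mono[OF card_permutes_extending[OF fin dom], where 'a = real]
    by (intro divide_right_mono) (simp_all only: of_nat_fact fact_ge_zero)
  also have "\<dots> \<le> (1 / real (?n - ?m)) ^ ?m"
  proof -
    have "real ((?n - ?m) ^ ?m * fact (?n - ?m)) \<le> real (fact ?n)"
      using pow_mult_fact_le[of ?m ?n] t by (simp only: of_nat_le_iff)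
    then show ?thesis using t by (simp add: field_simps)
  qed
  also have "\<dots> \<le> (1 / real (?n - t)) ^ ?m"
    using t by (intro power_mono divide_left_mono) auto
  finally show ?thesis .
qed

text \<open>A permutation preserving \<open>B\<close> also preserves \<open>A - B\<close>, and is
  determined by its two restrictions, each extended by the identity.\<close>

lemma card_permutes_stabilising:
  assumes "finite A" "B \<subseteq> A"
  shows "card {p. p permutes A \<and> p ` B = B} \<le> fact (card B) * fact (card A - card B)"
proof -
  let ?P = "{p. p permutes A \<and> p ` B = B}" and ?res = "\<lambda>p X x. if x \<in> X then p x else x"
  have fB: "finite B" using assms finite_subset by blast
  have "card ?P \<le> card ({r. r permutes B} \<times> {r. r permutes (A - B)})"
  proof (rule card_inj_on_le[where f = "\<lambda>p. (?res p B, ?res p (A - B))"])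
    show "inj_on (\<lambda>p. (?res p B, ?res p (A - B))) ?P"
    proof (rule inj_onI, rule ext)
      fix p q x assume "p \<in> ?P" "q \<in> ?P"
        and eq: "(?res p B, ?res p (A - B)) = (?res q B, ?res q (A - B))"
      then have pq: "p permutes A" "q permutes A" by auto
      from eq have "?res p B = ?res q B" "?res p (A - B) = ?res q (A - B)"
        by (simp_all only: prod.inject)
      from this[THEN fun_cong, of x] show "p x = q x"
        using permutes_not_in[OF pq(1), of x] permutes_not_in[OF pq(2), of x]
        by (auto split: if_splits)
    qed
    show "(\<lambda>p. (?res p B, ?res p (A - B))) ` ?P \<subseteq> {r. r permutes B} \<times> {r. r permutes (A - B)}"
    proof (rule image_subsetI)
      fix p assume "p \<in> ?P"
      then have p: "p permutes A" "p ` B = B" by auto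
      have inj: "inj_on p X" for X using permutes_inj[OF p(1)] inj_on_subset by blast
      have im: "p ` (A - B) = A - B"
        using p permutes_image[OF p(1)] by (simp add: image_set_diff permutes_inj)
      have "bij_betw (?res p X) X X" if "p ` X = X" for X
      proof -
        have "bij_betw p X X" using that inj by (simp add: bij_betw_def)
        then show ?thesis by (subst bij_betw_cong[where g = p]) auto
      qed
      then have "?res p X permutes X" if "p ` X = X" for X
        using that by (intro bij_imp_permutes) auto
      then have "?res p B permutes B \<and> ?res p (A - B) permutes (A - B)" using p(2) im by blast
      then show "(?res p B, ?res p (A - B)) \<in> {r. r permutes B} \<times> {r. r permutes (A - B)}" by blast
    qed
    show "finite ({r. r permutes B} \<times> {r. r permutes (A - B)})"
      using fB assms by (simp add: finite_permutations)
  qed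
  also have "\<dots> = fact (card B) * fact (card A - card B)"
    using fB assms by (simp add: card_cartesian_product card_permutations card_Diff_subset)
  finally show ?thesis .
qed

text \<open>The permutations carrying \<open>B\<close> onto \<open>T\<close> are either absent or a
  coset of the stabiliser of \<open>B\<close>, so at most \<open>card B\<close> factorial times
  \<open>card A - card B\<close> factorial of them exist.\<close>

lemma prob_permutes_image:
  assumes "finite A" "B \<subseteq> A"
  shows "measure_pmf.prob (pmf_of_set {p. p permutes A}) {p. p ` B = T} \<le> 1 / real (card A choose card B)"
proof -
  have "card {p. p permutes A \<and> p ` B = T} \<le> fact (card B) * fact (card A - card B)"
  proof (cases "{p. p permutes A \<and> p ` B = T} = {}")
    case False
    then obtain q where q: "q permutes A" "q ` B = T" by blast
    let ?P = "{p. p permutes A \<and> p ` B = T}"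
    have "card ?P \<le> card {p. p permutes A \<and> p ` B = B}"
    proof (rule card_inj_on_le[where f = "\<lambda>p. inv q \<circ> p"])
      show "inj_on (\<lambda>p. inv q \<circ> p) ?P"
        by (rule inj_on_inv_comp[OF q(1)])
      have "inv q ` T = (inv q \<circ> q) ` B" unfolding q(2)[symmetric] by (rule image_comp)
      then have T: "inv q ` T = B" by (simp only: permutes_inv_o(2)[OF q(1)] image_id id_apply)
      show "(\<lambda>p. inv q \<circ> p) ` ?P \<subseteq> {p. p permutes A \<and> p ` B = B}"
      proof (rule image_subsetI)
        fix p assume "p \<in> ?P"
        then have p: "p permutes A" "p ` B = T" by auto
        have "(inv q \<circ> p) ` B = B" unfolding image_comp[symmetric] p(2) by (rule T)
        then show "inv q \<circ> p \<in> {p. p permutes A \<and> p ` B = B}"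
          using permutes_compose[OF p(1) permutes_inv[OF q(1)]] by blast
      qed
      show "finite {p. p permutes A \<and> p ` B = B}"
        using finite_permutations[OF assms(1)] by simp
    qed
    then show ?thesis using card_permutes_stabilising[OF assms] by simp
  next
    case True
    show ?thesis unfolding True by simp
qed
  from of_nat_mono[OF this, where 'a = real]
  have "real (card {p. p permutes A \<and> p ` B = T}) \<le> fact (card B) * fact (card A - card B)"
    by (simp only: of_nat_fact of_nat_mult)
  moreover have "measure_pmf.prob (pmf_of_set {p. p permutes A}) {p. p ` B = T}
        = real (card {p. p permutes A \<and> p ` B = T}) / fact (card A)"
    by (simp only: measure_pmf_of_permutations[OF assms(1)] mem_Collect_eq)
  ultimately show ?thesis
    using card_mono[OF assms] by (simp add: binomial_fact divide_right_mono)
qed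

text \<open>Termwise comparison with the binomial expansion of \<open>Suc (card A) ^ d\<close>, in
  which every coefficient is at least 1.\<close>

lemma card_small_subsets:
  assumes "finite A" "0 < d"
  shows "card {X. X \<subseteq> A \<and> card X < d} \<le> Suc (card A) ^ d"
proof -
  have "card {X. X \<subseteq> A \<and> card X < d} \<le> card (\<Union>j<d. {X. X \<subseteq> A \<and> card X = j})"
    using assms by (intro card_mono) auto
  also have "\<dots> \<le> (\<Sum>j<d. card {X. X \<subseteq> A \<and> card X = j})" by (rule card_UN_le) simp
  also have "\<dots> = (\<Sum>j<d. card A choose j)" using n_subsets[OF assms(1)] by simp
  also have "\<dots> \<le> (\<Sum>j<d. (d choose j) * card A ^ j)"
  proof (intro sum_mono)
    fix j assume "j \<in> {..<d}"
    then have "1 \<le> d choose j" by (simp add: Suc_leI)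
    moreover have "card A choose j \<le> card A ^ j"
      by (cases "j \<le> card A") (auto simp: binomial_le_pow binomial_eq_0)
    ultimately show "card A choose j \<le> (d choose j) * card A ^ j"
      by (metis mult_le_mono mult_1)
  qed
  also have "\<dots> \<le> (\<Sum>j\<le>d. (d choose j) * card A ^ j)" by (rule sum_mono2) auto
  also have "\<dots> = Suc (card A) ^ d" using binomial[of "card A" 1 d] by (simp add: mult_ac)
  finally show ?thesis .
qed

text \<open>For a set of lift vertices with fibres \<open>B\<close> and \<open>B'\<close> over the
  ends of an arc, these index the lifted edges over that arc with exactly one end in the set. The
  index is the position in the tail fibre.\<close>

definition discrepancy :: "nat \<Rightarrow> nat set \<Rightarrow> nat set \<Rightarrow> (nat \<Rightarrow> nat) \<Rightarrow> nat set" where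
  "discrepancy n B B' p = {i \<in> {1..n}. (i \<in> B) \<noteq> (p i \<in> B')}"

text \<open>If \<open>X\<close> is the image of the discrepancy under \<open>p\<close>, then
  \<open>p\<close>
  B\<open>is the symmetric difference of\<close>B'\<open>and\<close>X\<open>. Hence a small discrepancy forces\<close>p
  \<open>B\<close> to be one of at most \<open>Suc n ^ d\<close> fixed sets, and a union bound over
  \<open>X\<close> applies.\<close>

lemma prob_discrepancy_less:
  assumes "B \<subseteq> {1..n}" "B' \<subseteq> {1..n}" "0 < d"
  shows "measure_pmf.prob (pmf_of_set {p. p permutes {1..n}}) {p. card (discrepancy n B B' p) < d}
           \<le> real (Suc n ^ d) / real (n choose card B)"
proof -
  let ?P = "pmf_of_set {p. p permutes {1..n}}" and ?Q = "{X. X \<subseteq> {1..n} \<and> card X < d}"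
  have "measure_pmf.prob ?P {p. card (discrepancy n B B' p) < d}
        \<le> measure_pmf.prob ?P (\<Union>X\<in>?Q. {p. p ` B = (B' - X) \<union> (X - B')})"
  proof (rule measure_pmf.finite_measure_mono_AE; (simp; fail)?)
    show "AE p in ?P. p \<in> {p. card (discrepancy n B B' p) < d} \<longrightarrow>
            p \<in> (\<Union>X\<in>?Q. {p. p ` B = (B' - X) \<union> (X - B')})"
    proof (rule AE_pmfI, rule impI)
      fix p assume "p \<in> set_pmf ?P" and *: "p \<in> {p. card (discrepancy n B B' p) < d}"
      then have p: "p permutes {1..n}"
        using permutes_nonempty_finite[of "{1..n}"] by (auto simp: set_pmf_of_set)
      let ?X = "p ` discrepancy n B B' p"
      have "?X \<subseteq> {1..n}" using permutes_image[OF p] by (auto simp: discrepancy_def)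
      moreover have "card ?X < d"
        using * card_image_le[of "discrepancy n B B' p" p] by (auto simp: discrepancy_def)
      moreover have "p ` B = (B' - ?X) \<union> (?X - B')"
      proof (intro set_eqI)
        fix j
        obtain i where j: "j = p i" using permutes_surj[OF p] by (metis surjD)
        have m: "p i \<in> p ` Y \<longleftrightarrow> i \<in> Y" for Y using permutes_inj[OF p] by (simp add: inj_image_mem_iff)
        have "i \<in> B \<Longrightarrow> i \<in> {1..n}" "p i \<in> B' \<Longrightarrow> i \<in> {1..n}"
          using assms permutes_in_image[OF p, of i] by auto
        then show "j \<in> p ` B \<longleftrightarrow> j \<in> (B' - ?X) \<union> (?X - B')"
          unfolding j Un_iff Diff_iff m by (auto simp: discrepancy_def)
      qed
      ultimately show "p \<in> (\<Union>X\<in>?Q. {p. p ` B = (B' - X) \<union> (X - B')})" by blast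
    qed
  qed
  also have "\<dots> \<le> (\<Sum>X\<in>?Q. measure_pmf.prob ?P {p. p ` B = (B' - X) \<union> (X - B')})"
    by (rule measure_pmf.finite_measure_subadditive_finite) auto
  also have "\<dots> \<le> (\<Sum>X\<in>?Q. 1 / real (n choose card B))"
    using prob_permutes_image[OF _ assms(1)] by (intro sum_mono) auto
  also have "\<dots> = real (card ?Q) / real (n choose card B)" by simp
  also have "\<dots> \<le> real (Suc n ^ d) / real (n choose card B)"
    using card_small_subsets[of "{1..n}" d] assms(3)
    by (intro divide_right_mono) (auto simp del: of_nat_power)
  finally show ?thesis .
qed

section \<open>The oriented base graph and deterministic bounds on cuts of its lifts\<close>

text \<open>An oriented base graph: \<open>D\<close> has one arc per undirected edge, so degrees are
  sums of in- and out-degrees in \<open>D\<close>. Connectedness is stated through crossing arcs,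
  the form in which the level argument for fibre sizes consumes it.\<close>

locale lift_base =
  fixes V :: "'a set" and D :: "'a rel" and \<delta> :: nat
  assumes finite_V: "finite V" and V_nonempty: "V \<noteq> {}"
    and D_subset: "D \<subseteq> V \<times> V" and D_antisym: "D \<inter> D\<inverse> = {}"
    and crossing_arc: "\<And>W. W \<subseteq> V \<Longrightarrow> W \<noteq> {} \<Longrightarrow> W \<noteq> V \<Longrightarrow> \<exists>(x, y)\<in>D. (x \<in> W) \<noteq> (y \<in> W)"
    and degree_ge: "\<And>v. v \<in> V \<Longrightarrow> \<delta> \<le> card {e \<in> D. fst e = v} + card {e \<in> D. snd e = v}"
    and \<delta>_ge: "5 \<le> \<delta>"
begin

lemma finite_D: "finite D"
  using D_subset finite_V finite_subset by blast

text \<open>The size of the edge boundary of the vertex set whose fibre over \<open>v\<close> is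
  \<open>F v\<close>.\<close>

definition cut :: "nat \<Rightarrow> ('a \<Rightarrow> nat set) \<Rightarrow> ('a \<times> 'a \<Rightarrow> nat \<Rightarrow> nat) \<Rightarrow> nat" where
  "cut n F \<pi> = (\<Sum>e\<in>D. card (discrepancy n (F (fst e)) (F (snd e)) (\<pi> e)))"

text \<open>The lifted edges with both ends in the set with fibres \<open>F\<close>, each listed
  once, in the direction inherited from \<open>D\<close>.\<close>

definition inner_arcs ::
  "('a \<Rightarrow> nat set) \<Rightarrow> ('a \<times> 'a \<Rightarrow> nat \<Rightarrow> nat) \<Rightarrow> (('a \<times> nat) \<times> ('a \<times> nat)) set" where
  "inner_arcs F \<pi> = {((x, i), (y, j)) | x i y j. (x, y) \<in> D \<and> i \<in> F x \<and> j \<in> F y \<and> \<pi> (x, y) i = j}"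

text \<open>The handshake identity with vertex weights \<open>g\<close>: grouping arcs by tail and
  by head weights each vertex by its degree.\<close>

lemma sum_degree: "\<delta> * (\<Sum>v\<in>V. g v) \<le> (\<Sum>e\<in>D. g (fst e) + g (snd e))" for g :: "'a \<Rightarrow> nat"
proof -
  have "(\<Sum>e\<in>D. g (h e)) = (\<Sum>v\<in>V. card {e \<in> D. h e = v} * g v)" if "h ` D \<subseteq> V" for h
  proof -
    have "(\<Sum>e\<in>D. g (h e)) = (\<Sum>v\<in>V. \<Sum>e\<in>{e \<in> D. h e = v}. g (h e))"
      using sum.group[OF finite_D finite_V that, of "\<lambda>e. g (h e)"] by simp
    also have "\<dots> = (\<Sum>v\<in>V. card {e \<in> D. h e = v} * g v)" by (intro sum.cong refl) simp
    finally show ?thesis .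
  qed
  from this[of fst] this[of snd]
  have "(\<Sum>e\<in>D. g (fst e) + g (snd e))
        = (\<Sum>v\<in>V. (card {e \<in> D. fst e = v} + card {e \<in> D. snd e = v}) * g v)"
    using D_subset by (force simp: sum.distrib add_mult_distrib)
  moreover have "(\<Sum>v\<in>V. \<delta> * g v) \<le> \<dots>"
    by (intro sum_mono mult_right_mono degree_ge) auto
  ultimately show ?thesis by (simp add: sum_distrib_left)
qed

lemma card_D_ge: "5 * card V \<le> 2 * card D"
proof -
  have "5 * card V \<le> \<delta> * card V" using \<delta>_ge by (rule mult_right_mono) simp
  also have "\<dots> \<le> 2 * card D" using sum_degree[of "\<lambda>_. 1"] by simp
  finally show ?thesis .
qed

end

locale lift_cut = lift_base +
  fixes n :: nat and \<pi> :: "'a \<times> 'a \<Rightarrow> nat \<Rightarrow> nat" and F :: "'a \<Rightarrow> nat set"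
  assumes perm: "\<And>e. e \<in> D \<Longrightarrow> \<pi> e permutes {1..n}"
    and fibre: "\<And>v. v \<in> V \<Longrightarrow> F v \<subseteq> {1..n}"
begin

lemma finite_fibre: "v \<in> V \<Longrightarrow> finite (F v)"
  using fibre finite_subset by blast

text \<open>Since \<open>\<pi> e\<close> is a bijection, each fibre point over an end of
  \<open>e\<close> lies on exactly one lifted edge over \<open>e\<close>. Inner edges account for
  two such points and crossing edges for one.\<close>

lemma card_fibres_arc:
  assumes "e \<in> D"
  shows "card (F (fst e)) + card (F (snd e))
    = 2 * card {i \<in> F (fst e). \<pi> e i \<in> F (snd e)}
      + card (discrepancy n (F (fst e)) (F (snd e)) (\<pi> e))"
proof -
  have V: "fst e \<in> V" "snd e \<in> V" using assms D_subset by auto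
  note p = perm[OF assms]
  \<comment> \<open>Pulling the head fibre back along \<open>\<pi> e\<close> turns the claim into
    one about two subsets of the tail fibre and their symmetric difference.\<close>
  let ?X = "F (fst e)" and ?Y = "\<pi> e -` F (snd e)"
  have "\<pi> e ` ?Y = F (snd e)" using permutes_surj[OF p] by (simp add: surj_image_vimage_eq)
  then have cY: "card (F (snd e)) = card ?Y"
    using card_image[OF inj_on_subset[OF permutes_inj[OF p]], of ?Y] by simp
  have Y: "?Y \<subseteq> {1..n}" using permutes_in_image[OF p] fibre[OF V(2)] by blast
  have fin: "finite ?X" "finite ?Y" using finite_fibre[OF V(1)] finite_subset[OF Y] by auto
  have "discrepancy n ?X (F (snd e)) (\<pi> e) = (?X - ?Y) \<union> (?Y - ?X)"
    using fibre[OF V(1)] Y by (auto simp: discrepancy_def)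
  then have "card (discrepancy n ?X (F (snd e)) (\<pi> e)) = card (?X - ?Y) + card (?Y - ?X)"
    using fin by (simp add: card_Un_disjoint Diff_Int_distrib2 inf_commute disjoint_iff)
  moreover have "card ?X = card (?X \<inter> ?Y) + card (?X - ?Y)" "card ?Y = card (?X \<inter> ?Y) + card (?Y - ?X)"
    using card_Int_Diff[of ?X ?Y] card_Int_Diff[of ?Y ?X] fin by (auto simp: Int_commute)
  moreover have "{i \<in> ?X. \<pi> e i \<in> F (snd e)} = ?X \<inter> ?Y" by auto
  ultimately show ?thesis using cY by simp
qed

text \<open>The inner edges over \<open>e\<close> number at most the smaller fibre size. The
  difference of sizes is written as the number of integer levels between them so that levels of
  several arcs can be united.\<close>

lemma card_fibre_diff_arc:
  assumes "e \<in> D"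
  shows "card {min (card (F (fst e))) (card (F (snd e)))<..max (card (F (fst e))) (card (F (snd e)))}
    \<le> card (discrepancy n (F (fst e)) (F (snd e)) (\<pi> e))"
proof -
  let ?I = "{i \<in> F (fst e). \<pi> e i \<in> F (snd e)}"
  have V: "fst e \<in> V" "snd e \<in> V" using assms D_subset by auto
  have "card ?I \<le> card (F (fst e))" using finite_fibre[OF V(1)] by (intro card_mono) auto
  moreover have "card ?I \<le> card (F (snd e))"
    using finite_fibre[OF V(2)] permutes_inj[OF perm[OF assms]]
    by (intro card_inj_on_le[where f = "\<pi> e"]) (auto intro: inj_on_subset)
  ultimately show ?thesis using card_fibres_arc[OF assms] by (auto simp: min_def max_def)
qed

text \<open>Every level between two fibre sizes is crossed by some arc, since the base is connected;
  each arc contributes at least the number of levels it crosses to the cut.\<close>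

lemma card_fibre_diff_le_cut:
  assumes "u \<in> V" "v \<in> V"
  shows "card (F v) \<le> card (F u) + cut n F \<pi>"
proof -
  let ?s = "\<lambda>v. card (F v)"
  let ?L = "\<lambda>e. {min (?s (fst e)) (?s (snd e))<..max (?s (fst e)) (?s (snd e))}"
  have "{?s u<..?s v} \<subseteq> (\<Union>e\<in>D. ?L e)"
  proof
    fix t assume t: "t \<in> {?s u<..?s v}"
    let ?W = "{w \<in> V. t \<le> ?s w}"
    have "u \<notin> ?W" "v \<in> ?W" using t assms by auto
    then obtain x y where xy: "(x, y) \<in> D" "(x \<in> ?W) \<noteq> (y \<in> ?W)"
      using crossing_arc[of ?W] assms by blast
    moreover have "x \<in> V" "y \<in> V" using xy D_subset by auto
    ultimately have "t \<in> ?L (x, y)" by auto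
    then show "t \<in> (\<Union>e\<in>D. ?L e)" using xy(1) by blast
  qed
  then have "card {?s u<..?s v} \<le> card (\<Union>e\<in>D. ?L e)" using finite_D by (intro card_mono) auto
  also have "\<dots> \<le> (\<Sum>e\<in>D. card (?L e))" by (rule card_UN_le[OF finite_D])
  also have "\<dots> \<le> cut n F \<pi>" unfolding cut_def by (intro sum_mono card_fibre_diff_arc)
  finally show ?thesis by simp
qed

lemma card_inner_arcs: "card (inner_arcs F \<pi>) = (\<Sum>e\<in>D. card {i \<in> F (fst e). \<pi> e i \<in> F (snd e)})"
proof -
  let ?f = "\<lambda>(e, i). ((fst e, i), (snd e, \<pi> e i))"
  let ?K = "Sigma D (\<lambda>e. {i \<in> F (fst e). \<pi> e i \<in> F (snd e)})"
  have "inner_arcs F \<pi> = ?f ` ?K"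
    unfolding inner_arcs_def by (force simp: image_iff)
  moreover have "inj_on ?f ?K" by (auto intro!: inj_onI simp: prod_eq_iff)
  ultimately have "card (inner_arcs F \<pi>) = card ?K" by (simp add: card_image)
  also have "\<dots> = (\<Sum>e\<in>D. card {i \<in> F (fst e). \<pi> e i \<in> F (snd e)})"
    using finite_D D_subset finite_fibre by (intro card_SigmaI) auto
  finally show ?thesis .
qed

lemma inner_arcs_subset: "inner_arcs F \<pi> \<subseteq> Sigma V F \<times> Sigma V F"
  using D_subset by (auto simp: inner_arcs_def)

lemma finite_total: "finite (Sigma V F)"
  using finite_V finite_fibre by auto

text \<open>The base is simple and loop-free, so the arcs inside a set and their converses are disjoint
  sets of off-diagonal pairs.\<close>

lemma card_inner_arcs_le:
  "2 * card (inner_arcs F \<pi>) \<le> card (Sigma V F) * (card (Sigma V F) - 1)"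
proof -
  let ?S = "Sigma V F" and ?I = "inner_arcs F \<pi>"
  have fin: "finite ?I" using inner_arcs_subset finite_total finite_subset by blast
  have disj: "?I \<inter> ?I\<inverse> = {}" using D_antisym by (auto simp: inner_arcs_def)
  have "2 * card ?I = card (?I \<union> ?I\<inverse>)"
    using fin disj by (simp add: card_Un_disjoint card_inverse)
  also have "\<dots> \<le> card (?S \<times> ?S - (\<lambda>x. (x, x)) ` ?S)"
  proof (rule card_mono)
    have "x \<noteq> y" if "((x, i), (y, j)) \<in> ?I" for x i y j
      using that D_antisym by (auto simp: inner_arcs_def)
    then show "?I \<union> ?I\<inverse> \<subseteq> ?S \<times> ?S - (\<lambda>x. (x, x)) ` ?S"
      using inner_arcs_subset by fastforce
  qed (use finite_total in auto)
  also have "\<dots> = card ?S * card ?S - card ?S"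
    using finite_total
    by (subst card_Diff_subset) (auto simp: card_cartesian_product card_image inj_on_def)
  finally show ?thesis by (simp add: diff_mult_distrib2)
qed

text \<open>With \<open>s\<close> vertices and \<open>e\<close> inner edges, degree counting gives
  \<delta> (s - 1) < 2 e, and simplicity gives 2 e \<le> s (s - 1). Together they force s > \<delta>
  \<ge> 5, and then 2 e > 5 (s - 1) \<ge> 4 s.\<close>

lemma card_inner_arcs_ge:
  assumes "Sigma V F \<noteq> {}" "cut n F \<pi> < \<delta>"
  shows "2 * card (Sigma V F) \<le> card (inner_arcs F \<pi>)"
proof -
  let ?s = "card (Sigma V F)" and ?e = "card (inner_arcs F \<pi>)"
  have s: "?s = (\<Sum>v\<in>V. card (F v))"
    using finite_V finite_fibre by (intro card_SigmaI) auto
  have "\<delta> * ?s \<le> (\<Sum>e\<in>D. card (F (fst e)) + card (F (snd e)))" unfolding s by (rule sum_degree)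
  also have "\<dots> = 2 * ?e + cut n F \<pi>"
    by (simp add: card_fibres_arc card_inner_arcs cut_def sum.distrib sum_distrib_left)
  finally have "\<delta> * ?s < 2 * ?e + \<delta>" using assms(2) by linarith
  moreover obtain m where m: "?s = Suc m"
    using assms(1) finite_total by (metis card_eq_0_iff not0_implies_Suc)
  ultimately have e: "\<delta> * m < 2 * ?e" by simp
  also have "2 * ?e \<le> Suc m * m" using card_inner_arcs_le m by simp
  finally have "\<delta> * m < Suc m * m" .
  then have "\<delta> < Suc m" using mult_less_cancel2 by blast
  moreover have "5 * m \<le> \<delta> * m" using \<delta>_ge by simp
  ultimately show ?thesis using e m \<delta>_ge by linarith
qed

end

section \<open>Counting estimates for the union bounds\<close>

lemma choose_le_pow: "(n choose k) \<le> n ^ k"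
  by (cases "k \<le> n") (auto simp: binomial_le_pow binomial_eq_0)

text \<open>One factor \<open>Suc n\<close> pays for the choice of the size, the other
  \<open>d\<close> for replacing that size by \<open>a\<close>.\<close>

lemma card_near_subsets:
  assumes "a \<le> n"
  shows "card {B. B \<subseteq> {1..n} \<and> a \<le> card B + d \<and> card B \<le> a + d} \<le> Suc n ^ Suc d * (n choose a)"
proof -
  let ?I = "{b \<in> {..n}. a \<le> b + d \<and> b \<le> a + d}"
  have "{B. B \<subseteq> {1..n} \<and> a \<le> card B + d \<and> card B \<le> a + d}
        \<subseteq> (\<Union>b\<in>?I. {B. B \<subseteq> {1..n} \<and> card B = b})"
    using card_mono[of "{1..n}"] by fastforce
  then have "card {B. B \<subseteq> {1..n} \<and> a \<le> card B + d \<and> card B \<le> a + d}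
        \<le> card (\<Union>b\<in>?I. {B. B \<subseteq> {1..n} \<and> card B = b})"
    by (rule card_mono[rotated]) auto
  also have "\<dots> \<le> (\<Sum>b\<in>?I. card {B. B \<subseteq> {1..n} \<and> card B = b})" by (rule card_UN_le) simp
  also have "\<dots> = (\<Sum>b\<in>?I. n choose b)" by (simp add: n_subsets)
  also have "\<dots> \<le> (\<Sum>b\<in>?I. Suc n ^ d * (n choose a))"
    using assms by (intro sum_mono choose_near_le) auto
  also have "\<dots> = card ?I * (Suc n ^ d * (n choose a))" by simp
  also have "\<dots> \<le> Suc n * (Suc n ^ d * (n choose a))"
    using card_mono[of "{..n}" ?I] by (intro mult_right_mono) auto
  finally show ?thesis by (simp only: power_Suc mult.assoc)
qed

text \<open>Below the middle, \<open>n choose a\<close> is at least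
  \<open>n choose (10 * d)\<close>, hence at least the power \<open>10 * d\<close> of n / (10 d).
  The square of that quotient is at least n + 1 because n is at least 200 times the square of d,
  which halves the exponent.\<close>

lemma choose_ge_pow:
  assumes "0 < d" "200 * d\<^sup>2 \<le> n" "10 * d \<le> a" "2 * a \<le> n"
  shows "Suc n ^ (5 * d) \<le> (n choose a)"
proof -
  have "real (100 * d\<^sup>2 * Suc n) \<le> real (n\<^sup>2)"
  proof -
    have "1 \<le> n" using assms by linarith
    have "100 * d\<^sup>2 * Suc n \<le> 100 * d\<^sup>2 * (2 * n)" using \<open>1 \<le> n\<close> by (intro mult_left_mono) auto
    also have "\<dots> = (200 * d\<^sup>2) * n" by simp
    also have "\<dots> \<le> n * n" using assms(2) by (rule mult_right_mono) simp
    finally show ?thesis unfolding power2_eq_square[of n] by (rule of_nat_mono)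
  qed
  then have "real (Suc n) \<le> (real n / real (10 * d))\<^sup>2"
    using assms(1) by (simp add: power_divide power_mult_distrib field_simps)
  then have "real (Suc n) ^ (5 * d) \<le> ((real n / real (10 * d))\<^sup>2) ^ (5 * d)"
    by (rule power_mono) simp
  also have "\<dots> = (real n / real (10 * d)) ^ (10 * d)" by (simp flip: power_mult)
  also have "\<dots> \<le> real (n choose (10 * d))"
    using assms by (intro binomial_ge_n_over_k_pow_k) auto
  also have "\<dots> \<le> real (n choose a)"
    using binomial_mono[OF assms(3,4)] by simp
  finally have "real (Suc n ^ (5 * d)) \<le> real (n choose a)" by simp
  then show ?thesis by (simp only: of_nat_le_iff)
qed

section \<open>Union bounds for the two bad events\<close>

context lift_base
begin

definition perms :: "nat \<Rightarrow> ('a \<times> 'a \<Rightarrow> nat \<Rightarrow> nat) pmf" where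
  "perms n = Pi_pmf D id (\<lambda>_. pmf_of_set {p. p permutes {1..n}})"

lemma set_pmf_perms:
  assumes "\<pi> \<in> set_pmf (perms n)" "e \<in> D"
  shows "\<pi> e permutes {1..n}"
proof -
  have "\<pi> e \<in> set_pmf (pmf_of_set {p. p permutes {1..n}})"
    using assms unfolding perms_def set_Pi_pmf[OF finite_D] by (cases e) (auto simp: PiE_dflt_def)
  then show ?thesis
    unfolding set_pmf_of_set[OF permutes_nonempty_finite[OF finite_atLeastAtMost]] by (rule CollectD)
qed

text \<open>Sorting \<open>M\<close> by base arc gives one partial prescription per permutation.
  Independence makes the probability a product, and the exponents add up to
  \<open>card M\<close>.\<close>

lemma prob_arcs:
  assumes M: "finite M" "M \<subseteq> {((x, i), (y, j)). (x, y) \<in> D \<and> i \<in> {1..n}}"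
    and t: "card M \<le> t" "t < n"
  shows "measure_pmf.prob (perms n) {\<pi>. \<forall>((x, i), (y, j))\<in>M. \<pi> (x, y) i = j}
           \<le> (1 / real (n - t)) ^ card M"
proof -
  \<comment> \<open>\<open>?M e\<close> holds the values prescribed for the permutation on
    \<open>e\<close>; \<open>?f\<close> reassembles lifted arcs from them.\<close>
  let ?M = "\<lambda>e. {(i, j). ((fst e, i), (snd e, j)) \<in> M}"
  let ?f = "\<lambda>(e, (i, j)). ((fst e, i), (snd e, j))"
  have inj: "inj ?f" by (auto intro!: injI simp: prod_eq_iff)
  have Mf: "M = ?f ` Sigma D ?M"
  proof (rule set_eqI, rule iffI)
    fix m assume m: "m \<in> M"
    obtain x i y j where xy: "m = ((x, i), (y, j))" by (metis surj_pair)
    then have "((x, y), (i, j)) \<in> Sigma D ?M" using M(2) m by auto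
    moreover have "m = ?f ((x, y), (i, j))" using xy by simp
    ultimately show "m \<in> ?f ` Sigma D ?M" by (rule rev_image_eqI)
  qed auto
  have "finite (?f ` Sigma D ?M)" using M(1) Mf by (rule back_subst)
  then have fS: "finite (Sigma D ?M)" by (rule finite_imageD[OF _ inj_on_subset[OF inj subset_UNIV]])
  have fin: "finite (?M e)" if "e \<in> D" for e
  proof -
    have "Pair e ` ?M e \<subseteq> Sigma D ?M" using that by auto
    then have "finite (Pair e ` ?M e)" using fS finite_subset by blast
    then show ?thesis by (rule finite_imageD) (simp add: inj_on_def)
  qed
  have "card M = card (Sigma D ?M)"
    by (subst Mf) (rule card_image[OF inj_on_subset[OF inj subset_UNIV]])
  also have "\<dots> = (\<Sum>e\<in>D. card (?M e))" using finite_D fin by (intro card_SigmaI) auto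
  finally have cM: "card M = (\<Sum>e\<in>D. card (?M e))" .
  have "{\<pi>. \<forall>((x, i), (y, j))\<in>M. \<pi> (x, y) i = j} = Pi D (\<lambda>e. {p. \<forall>(i, j)\<in>?M e. p i = j})"
  proof (rule set_eqI, rule iffI)
    fix \<pi> assume "\<pi> \<in> Pi D (\<lambda>e. {p. \<forall>(i, j)\<in>?M e. p i = j})"
    then have "\<pi> (x, y) i = j" if "((x, i), (y, j)) \<in> M" for x y i j
      using that M(2) by (auto simp: Pi_iff)
    then show "\<pi> \<in> {\<pi>. \<forall>((x, i), (y, j))\<in>M. \<pi> (x, y) i = j}" by auto
  qed auto
  then have "measure_pmf.prob (perms n) {\<pi>. \<forall>((x, i), (y, j))\<in>M. \<pi> (x, y) i = j}
      = (\<Prod>e\<in>D. measure_pmf.prob (pmf_of_set {p. p permutes {1..n}}) {p. \<forall>(i, j)\<in>?M e. p i = j})"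
    unfolding perms_def by (simp only: measure_Pi_pmf_Pi[OF finite_D])
  also have "\<dots> \<le> (\<Prod>e\<in>D. (1 / real (n - t)) ^ card (?M e))"
  proof (intro prod_mono conjI)
    fix e assume e: "e \<in> D"
    have "card (?M e) \<le> t" using cM t(1) member_le_sum[of e D "\<lambda>e. card (?M e)"] e finite_D by simp
    moreover have "fst ` ?M e \<subseteq> {1..n}" using M(2) by force
    ultimately show "measure_pmf.prob (pmf_of_set {p. p permutes {1..n}}) {p. \<forall>(i, j)\<in>?M e. p i = j}
        \<le> (1 / real (n - t)) ^ card (?M e)"
      using prob_permutes_extending[of "{1..n}" "?M e" t] fin[OF e] t(2)
      by (simp only: finite_atLeastAtMost card_atLeastAtMost diff_Suc_1)
  qed simp
  also have "\<dots> = (1 / real (n - t)) ^ card M" unfolding cM by (simp only: power_sum)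
  finally show ?thesis .
qed

text \<open>Some \<open>s\<close> lift vertices span at least \<open>2 * s\<close> edges. Fixing
  exactly \<open>2 * s\<close> of them as a witness \<open>M\<close> makes the union bound run over
  sets of one size.\<close>

definition dense_part :: "nat \<Rightarrow> nat \<Rightarrow> ('a \<times> 'a \<Rightarrow> nat \<Rightarrow> nat) set" where
  "dense_part n s = {\<pi>. \<exists>S M. S \<subseteq> V \<times> {1..n} \<and> card S = s \<and> M \<subseteq> S \<times> S \<and> card M = 2 * s
     \<and> M \<subseteq> {((x, i), (y, j)). (x, y) \<in> D} \<and> (\<forall>((x, i), (y, j))\<in>M. \<pi> (x, y) i = j)}"

text \<open>With k = \<open>card V\<close>, there are at most (k n)^s (s^2)^(2 s) pairs
  \<open>(S, M)\<close>. As 4 s \<le> n, the denominator n - 2 s is at least n / 2, so each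
  \<open>M\<close> occurs with probability at most (2 / n)^(2 s).\<close>

lemma prob_dense_part:
  assumes "4 * s \<le> n" "0 < n"
  shows "measure_pmf.prob (perms n) (dense_part n s) \<le> (4 * real (card V) * real s ^ 4 / real n) ^ s"
proof -
  let ?X = "{((x, i), (y, j)). (x, y) \<in> D}"
  let ?\<S> = "{S. S \<subseteq> V \<times> {1..n} \<and> card S = s}" and ?\<M> = "\<lambda>S. {M. M \<subseteq> S \<times> S \<and> card M = 2 * s}"
  let ?Q = "{(S, M). S \<in> ?\<S> \<and> M \<in> ?\<M> S \<and> M \<subseteq> ?X}"
  let ?E = "\<lambda>M. {\<pi>. \<forall>((x, i), (y, j))\<in>M. \<pi> (x, y) i = j}"
  have fVn: "finite (V \<times> {1..n})" using finite_V by simp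
  have fin: "finite S" if "S \<in> ?\<S>" for S using that finite_subset[OF _ fVn] by blast
  have fS: "finite ?\<S>" by (rule finite_subset[of _ "Pow (V \<times> {1..n})"]) (use fVn in auto)
  have fM: "finite (?\<M> S)" if "S \<in> ?\<S>" for S
    by (rule finite_subset[of _ "Pow (S \<times> S)"]) (use fin[OF that] in auto)
  have fSig: "finite (Sigma ?\<S> ?\<M>)" using fS fM by (rule finite_SigmaI)
  have fQ: "finite ?Q" by (rule finite_subset[OF _ fSig]) auto
  have "card ?Q \<le> card (Sigma ?\<S> ?\<M>)" by (rule card_mono[OF fSig]) auto
  also have "\<dots> = (\<Sum>S\<in>?\<S>. card (?\<M> S))" using fS fM by (intro card_SigmaI ballI)
  also have "\<dots> = (\<Sum>S\<in>?\<S>. (s * s) choose (2 * s))"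
  proof (intro sum.cong refl)
    fix S assume S: "S \<in> ?\<S>"
    then have "card (S \<times> S) = s * s" by (simp add: card_cartesian_product)
    then show "card (?\<M> S) = (s * s) choose (2 * s)"
      using n_subsets[of "S \<times> S" "2 * s"] fin[OF S] by simp
  qed
  also have "\<dots> = ((card V * n) choose s) * ((s * s) choose (2 * s))"
    using n_subsets[OF fVn, of s] by (simp add: card_cartesian_product)
  also have "\<dots> \<le> (card V * n) ^ s * (s * s) ^ (2 * s)"
    by (intro mult_mono choose_le_pow) auto
  finally have "card ?Q \<le> (card V * n) ^ s * (s * s) ^ (2 * s)" .
  from of_nat_mono[OF this, where 'a = real]
  have cQ: "real (card ?Q) \<le> real (card V * n) ^ s * real (s * s) ^ (2 * s)"
    by (simp only: of_nat_mult of_nat_power)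
  have "dense_part n s \<subseteq> (\<Union>q\<in>?Q. ?E (snd q))"
  proof
    fix \<pi> assume "\<pi> \<in> dense_part n s"
    then obtain S M where "(S, M) \<in> ?Q" "\<pi> \<in> ?E M" unfolding dense_part_def by blast
    then show "\<pi> \<in> (\<Union>q\<in>?Q. ?E (snd q))" by (intro UN_I[of "(S, M)"]) (simp_all only: snd_conv)
  qed
  then have "measure_pmf.prob (perms n) (dense_part n s) \<le> measure_pmf.prob (perms n) (\<Union>q\<in>?Q. ?E (snd q))"
    by (intro measure_pmf.finite_measure_mono) auto
  also have "\<dots> \<le> (\<Sum>q\<in>?Q. measure_pmf.prob (perms n) (?E (snd q)))"
    using fQ by (intro measure_pmf.finite_measure_subadditive_finite) auto
  also have "\<dots> \<le> (\<Sum>q\<in>?Q. (2 / real n) ^ (2 * s))"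
  proof (rule sum_mono)
    fix q assume "q \<in> ?Q"
    then obtain S M where q: "q = (S, M)" "S \<in> ?\<S>" "M \<in> ?\<M> S" "M \<subseteq> ?X" by blast
    have "M \<subseteq> {((x, i), (y, j)). (x, y) \<in> D \<and> i \<in> {1..n}}" using q(2-4) by blast
    moreover have "finite M" using q(3) fin[OF q(2)] by (auto intro: finite_subset)
    moreover have "card M \<le> 2 * s" "2 * s < n" "card M = 2 * s" using q(3) assms by auto
    ultimately have "measure_pmf.prob (perms n) (?E M) \<le> (1 / real (n - 2 * s)) ^ (2 * s)"
      using prob_arcs[of M n "2 * s"] by simp
    also have "\<dots> \<le> (2 / real n) ^ (2 * s)"
      using assms by (intro power_mono) (auto simp: field_simps of_nat_diff)
    finally show "measure_pmf.prob (perms n) (?E (snd q)) \<le> (2 / real n) ^ (2 * s)" using q(1) by simp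
  qed
  also have "\<dots> = real (card ?Q) * (2 / real n) ^ (2 * s)" by simp
  also have "\<dots> \<le> (real (card V * n) ^ s * real (s * s) ^ (2 * s)) * (2 / real n) ^ (2 * s)"
    using cQ by (rule mult_right_mono) simp
  also have "\<dots> = (real (card V * n) * (real (s * s))\<^sup>2 * (2 / real n)\<^sup>2) ^ s"
    by (simp only: power_mult_distrib power_mult)
  also have "real (card V * n) * (real (s * s))\<^sup>2 * (2 / real n)\<^sup>2 = 4 * real (card V) * real s ^ 4 / real n"
    using assms(2) by (simp add: power2_eq_square power4_eq_xxxx field_simps)
  finally show ?thesis .
qed

text \<open>If the base of the power at \<open>s = t\<close> is at most 1, each of the
  \<open>t\<close> terms is at most that base, since \<open>s\<close> is at least 1. Otherwise, for
  positive \<open>t\<close>, the claimed bound exceeds 1.\<close>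

lemma prob_UN_dense_part:
  assumes "4 * t \<le> n" "0 < n"
  shows "measure_pmf.prob (perms n) (\<Union>s\<in>{1..t}. dense_part n s) \<le> 4 * real (card V) * real t ^ 5 / real n"
proof (cases "4 * real (card V) * real t ^ 4 / real n \<le> 1")
  case True
  have "measure_pmf.prob (perms n) (\<Union>s\<in>{1..t}. dense_part n s)
        \<le> (\<Sum>s\<in>{1..t}. measure_pmf.prob (perms n) (dense_part n s))"
    by (intro measure_pmf.finite_measure_subadditive_finite) auto
  also have "\<dots> \<le> (\<Sum>s\<in>{1..t}. 4 * real (card V) * real t ^ 4 / real n)"
  proof (rule sum_mono)
    fix s assume s: "s \<in> {1..t}"
    have "measure_pmf.prob (perms n) (dense_part n s) \<le> (4 * real (card V) * real s ^ 4 / real n) ^ s"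
      using s assms by (intro prob_dense_part) auto
    also have "\<dots> \<le> (4 * real (card V) * real t ^ 4 / real n) ^ s"
      using s by (intro power_mono divide_right_mono mult_left_mono) auto
    also have "\<dots> \<le> (4 * real (card V) * real t ^ 4 / real n) ^ 1"
      using s True by (intro power_decreasing) auto
    finally show "measure_pmf.prob (perms n) (dense_part n s) \<le> 4 * real (card V) * real t ^ 4 / real n"
      by simp
  qed
  also have "\<dots> = 4 * real (card V) * real t ^ 5 / real n" by (simp add: power_numeral_reduce)
  finally show ?thesis .
next
  case False
  show ?thesis
  proof (cases "t = 0")
    case True then show ?thesis by simp
  next
    case t: False
    have "measure_pmf.prob (perms n) (\<Union>s\<in>{1..t}. dense_part n s) \<le> 1 * 1" by simp
    also have "\<dots> \<le> real t * (4 * real (card V) * real t ^ 4 / real n)"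
      using False t by (intro mult_mono) auto
    finally show ?thesis by (simp add: power_numeral_reduce mult_ac)
  qed
qed

text \<open>A cut smaller than \<delta> is relaxed to one condition per arc, so that independence of
  the permutations can be used for each fixed \<open>F\<close>.\<close>

definition balanced_cut :: "nat \<Rightarrow> nat \<Rightarrow> ('a \<times> 'a \<Rightarrow> nat \<Rightarrow> nat) set" where
  "balanced_cut n a = {\<pi>. \<exists>F. (\<forall>v\<in>V. F v \<subseteq> {1..n} \<and> a \<le> card (F v) + \<delta> \<and> card (F v) \<le> a + \<delta>)
     \<and> (\<forall>e\<in>D. card (discrepancy n (F (fst e)) (F (snd e)) (\<pi> e)) < \<delta>)}"

text \<open>Let X = \<open>n choose a\<close>. The choice of fibres costs about
  X^(\<open>card V\<close>), while the arcs gain X^(\<open>card D\<close>), up to powers of n + 1.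
  Since \<open>card D\<close> is at least 5/2 times \<open>card V\<close>, the surplus of X absorbs
  these powers and leaves a square for the later sum over \<open>a\<close>.\<close>

lemma prob_balanced_cut:
  assumes a: "10 * \<delta> \<le> a" "2 * a \<le> n" and n: "200 * \<delta>\<^sup>2 \<le> n"
  shows "measure_pmf.prob (perms n) (balanced_cut n a) \<le> 1 / (real (Suc n))\<^sup>2"
proof -
  let ?N = "real (Suc n)" and ?X = "n choose a" and ?k = "card V" and ?m = "card D"
  let ?B = "{B. B \<subseteq> {1..n} \<and> a \<le> card B + \<delta> \<and> card B \<le> a + \<delta>}"
  let ?Q = "PiE V (\<lambda>_. ?B)"
  let ?E = "\<lambda>F. Pi D (\<lambda>e. {p. card (discrepancy n (F (fst e)) (F (snd e)) p) < \<delta>})"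
  have fQ: "finite ?Q" using finite_V by (intro finite_PiE) auto
  have X: "0 < ?X" using a by simp
  have "card ?Q = card ?B ^ ?k" using finite_V by (simp add: card_PiE)
  also have "\<dots> \<le> (Suc n ^ Suc \<delta> * ?X) ^ ?k"
    using a by (intro power_mono card_near_subsets) auto
  finally have "card ?Q \<le> (Suc n ^ Suc \<delta> * ?X) ^ ?k" .
  from of_nat_mono[OF this, where 'a = real]
  have cQ: "real (card ?Q) \<le> (?N ^ Suc \<delta> * real ?X) ^ ?k"
    by (simp only: of_nat_mult of_nat_power)
  have "balanced_cut n a \<subseteq> (\<Union>F\<in>?Q. ?E F)"
  proof
    fix \<pi> assume "\<pi> \<in> balanced_cut n a"
    then obtain F where F: "\<forall>v\<in>V. F v \<subseteq> {1..n} \<and> a \<le> card (F v) + \<delta> \<and> card (F v) \<le> a + \<delta>"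
      "\<forall>e\<in>D. card (discrepancy n (F (fst e)) (F (snd e)) (\<pi> e)) < \<delta>"
      unfolding balanced_cut_def by blast
    \<comment> \<open>Only the values of \<open>F\<close> on \<open>V\<close> matter; restricting it
      makes the family finite.\<close>
    have "restrict F V \<in> ?Q" using F(1) by auto
    moreover have "\<pi> \<in> ?E (restrict F V)"
    proof (rule Pi_I)
      fix e assume e: "e \<in> D"
      then have "fst e \<in> V" "snd e \<in> V" using D_subset by auto
      then show "\<pi> e \<in> {p. card (discrepancy n (restrict F V (fst e)) (restrict F V (snd e)) p) < \<delta>}"
        using F(2) e by simp
    qed
    ultimately show "\<pi> \<in> (\<Union>F\<in>?Q. ?E F)" by blast
  qed
  then have "measure_pmf.prob (perms n) (balanced_cut n a) \<le> measure_pmf.prob (perms n) (\<Union>F\<in>?Q. ?E F)"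
    by (intro measure_pmf.finite_measure_mono) auto
  also have "\<dots> \<le> (\<Sum>F\<in>?Q. measure_pmf.prob (perms n) (?E F))"
    using fQ by (intro measure_pmf.finite_measure_subadditive_finite) auto
  also have "\<dots> \<le> (\<Sum>F\<in>?Q. (?N ^ (2 * \<delta>) / real ?X) ^ ?m)"
  proof (rule sum_mono)
    fix F assume F: "F \<in> ?Q"
    have "measure_pmf.prob (perms n) (?E F) = (\<Prod>e\<in>D. measure_pmf.prob (pmf_of_set {p. p permutes {1..n}})
        {p. card (discrepancy n (F (fst e)) (F (snd e)) p) < \<delta>})"
      unfolding perms_def by (simp only: measure_Pi_pmf_Pi[OF finite_D])
    also have "\<dots> \<le> (\<Prod>e\<in>D. ?N ^ (2 * \<delta>) / real ?X)"
    proof (intro prod_mono conjI)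
      fix e assume "e \<in> D"
      then have "fst e \<in> V" "snd e \<in> V" using D_subset by auto
      then have B: "F (fst e) \<in> ?B" "F (snd e) \<in> ?B" using F by (meson PiE_mem)+
      let ?Y = "n choose card (F (fst e))"
      have "card (F (fst e)) \<le> n" using B(1) card_mono[of "{1..n}" "F (fst e)"] by simp
      then have XY: "?X \<le> Suc n ^ \<delta> * ?Y" "0 < ?Y" using B a by (auto intro!: choose_near_le)
      have "measure_pmf.prob (pmf_of_set {p. p permutes {1..n}})
          {p. card (discrepancy n (F (fst e)) (F (snd e)) p) < \<delta>} \<le> real (Suc n ^ \<delta>) / real ?Y"
        using B \<delta>_ge by (intro prob_discrepancy_less) auto
      \<comment> \<open>Replacing the actual fibre size by \<open>a\<close> costs a second factor
        \<open>?N ^ \<delta>\<close>.\<close>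
      also have "\<dots> \<le> ?N ^ (2 * \<delta>) / real ?X"
      proof -
        from of_nat_mono[OF XY(1), where 'a = real]
        have "real ?X \<le> ?N ^ \<delta> * real ?Y" by (simp only: of_nat_mult of_nat_power)
        then have "?N ^ \<delta> * real ?X \<le> ?N ^ \<delta> * (?N ^ \<delta> * real ?Y)" by (rule mult_left_mono) simp
        also have "\<dots> = ?N ^ (2 * \<delta>) * real ?Y" by (simp only: mult_2 power_add mult.assoc)
        finally show ?thesis using X XY(2) by (simp add: field_simps)
      qed
      finally show "measure_pmf.prob (pmf_of_set {p. p permutes {1..n}})
          {p. card (discrepancy n (F (fst e)) (F (snd e)) p) < \<delta>} \<le> ?N ^ (2 * \<delta>) / real ?X" .
    qed simp
    also have "\<dots> = (?N ^ (2 * \<delta>) / real ?X) ^ ?m" by simp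
    finally show "measure_pmf.prob (perms n) (?E F) \<le> (?N ^ (2 * \<delta>) / real ?X) ^ ?m" .
  qed
  also have "\<dots> = real (card ?Q) * (?N ^ (2 * \<delta>) / real ?X) ^ ?m" by simp
  also have "\<dots> \<le> (?N ^ Suc \<delta> * real ?X) ^ ?k * (?N ^ (2 * \<delta>) / real ?X) ^ ?m"
    using cQ by (rule mult_right_mono) simp
  also have "\<dots> \<le> 1 / ?N\<^sup>2"
  proof -
    \<comment> \<open>\<open>l\<close> is the surplus of arcs over vertices, that is, the net power
      of 1/X that remains.\<close>
    obtain l where l: "?m = ?k + l" "3 * ?k \<le> 2 * l"
      using card_D_ge le_Suc_ex[of ?k ?m] by auto
    have k: "1 \<le> ?k" using V_nonempty finite_V by (simp add: Suc_leI card_gt_0_iff)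
    have "\<delta> * (3 * ?k) \<le> \<delta> * (2 * l)" using l(2) by (rule mult_left_mono) simp
    then have "3 * (\<delta> * ?k) \<le> 2 * (\<delta> * l)" by (simp only: mult.left_commute)
    moreover have "5 * ?k \<le> \<delta> * ?k" using \<delta>_ge by (rule mult_right_mono) simp
    moreover have "2 + Suc \<delta> * ?k + 2 * \<delta> * ?m = 2 + ?k + 3 * (\<delta> * ?k) + 2 * (\<delta> * l)"
      unfolding l(1) by (simp add: algebra_simps)
    moreover have "5 * \<delta> * l = 5 * (\<delta> * l)" by (rule mult.assoc)
    \<comment> \<open>The terms 3 \<delta> k and 2 \<delta> l together are at most 4 \<delta> l. The
      remaining \<delta> l is at least 15 k / 2, which covers 2 + k.\<close>
    ultimately have ex: "2 + Suc \<delta> * ?k + 2 * \<delta> * ?m \<le> 5 * \<delta> * l" using k by linarith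
    have "real (Suc n ^ (5 * \<delta>)) \<le> real ?X"
      using choose_ge_pow[OF _ n a] \<delta>_ge by (intro of_nat_mono) simp
    then have NX: "?N ^ (5 * \<delta>) \<le> real ?X" by (simp only: of_nat_power)
    have "?N ^ (2 + Suc \<delta> * ?k + 2 * \<delta> * ?m) \<le> ?N ^ (5 * \<delta> * l)"
      using ex by (rule power_increasing) simp
    also have "\<dots> = (?N ^ (5 * \<delta>)) ^ l" by (rule power_mult)
    also have "\<dots> \<le> real ?X ^ l" using NX by (rule power_mono) simp
    finally have "?N\<^sup>2 * (?N ^ Suc \<delta>) ^ ?k * (?N ^ (2 * \<delta>)) ^ ?m \<le> real ?X ^ l"
      by (simp only: power_add power_mult)
    then have "?N\<^sup>2 * (?N ^ Suc \<delta>) ^ ?k * (?N ^ (2 * \<delta>)) ^ ?m * real ?X ^ ?k \<le> real ?X ^ l * real ?X ^ ?k"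
      by (rule mult_right_mono) simp
    also have "\<dots> = real ?X ^ ?m" unfolding l(1) by (simp add: power_add)
    finally show ?thesis
      using X by (simp only: power_mult_distrib power_divide) (simp add: field_simps)
  qed
  finally show ?thesis .
qed

lemma prob_UN_balanced_cut:
  assumes "200 * \<delta>\<^sup>2 \<le> n"
  shows "measure_pmf.prob (perms n) (\<Union>a\<in>{10 * \<delta>..n div 2}. balanced_cut n a) \<le> 1 / real (Suc n)"
proof -
  have "measure_pmf.prob (perms n) (\<Union>a\<in>{10 * \<delta>..n div 2}. balanced_cut n a)
        \<le> (\<Sum>a\<in>{10 * \<delta>..n div 2}. measure_pmf.prob (perms n) (balanced_cut n a))"
    by (intro measure_pmf.finite_measure_subadditive_finite) auto
  also have "\<dots> \<le> (\<Sum>a\<in>{10 * \<delta>..n div 2}. 1 / (real (Suc n))\<^sup>2)"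
    using assms by (intro sum_mono prob_balanced_cut) auto
  also have "\<dots> = real (card {10 * \<delta>..n div 2}) * (1 / (real (Suc n))\<^sup>2)" by simp
  also have "\<dots> \<le> real (Suc n) * (1 / (real (Suc n))\<^sup>2)"
    by (intro mult_right_mono of_nat_mono) auto
  also have "\<dots> = 1 / real (Suc n)" by (simp add: power2_eq_square)
  finally show ?thesis .
qed

end

section \<open>Reducing a small cut to one of the bad events\<close>

context lift_cut
begin

text \<open>Complementing flips membership at both ends of every lifted edge, because each
  \<open>\<pi> e\<close> preserves \<open>{1..n}\<close>.\<close>

lemma cut_complement: "cut n (\<lambda>v. {1..n} - F v) \<pi> = cut n F \<pi>"
proof -
  have "discrepancy n ({1..n} - F (fst e)) ({1..n} - F (snd e)) (\<pi> e)
        = discrepancy n (F (fst e)) (F (snd e)) (\<pi> e)" if "e \<in> D" for e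
  proof -
    have "\<pi> e i \<in> {1..n} \<longleftrightarrow> i \<in> {1..n}" for i using permutes_in_image[OF perm[OF that]] by blast
    then show ?thesis unfolding discrepancy_def by blast
  qed
  then show ?thesis by (simp add: cut_def)
qed

text \<open>All fibre sizes are within \<delta> of that of \<open>F r\<close>. If the latter is at
  least 10 \<delta>, the cut is balanced around it; otherwise every fibre has at most 11 \<delta>
  points, and the whole set is a small dense part.\<close>

lemma small_cut_cases:
  assumes "Sigma V F \<noteq> {}" "cut n F \<pi> < \<delta>" and r: "r \<in> V" "2 * card (F r) \<le> n"
  shows "\<pi> \<in> (\<Union>s\<in>{1..11 * \<delta> * card V}. dense_part n s)
           \<union> (\<Union>a\<in>{10 * \<delta>..n div 2}. balanced_cut n a)"
proof (cases "10 * \<delta> \<le> card (F r)")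
  case True
  have "card (discrepancy n (F (fst e)) (F (snd e)) (\<pi> e)) < \<delta>" if "e \<in> D" for e
    using assms(2) member_le_sum[of e D "\<lambda>e. card (discrepancy n (F (fst e)) (F (snd e)) (\<pi> e))"]
      that finite_D by (simp add: cut_def)
  moreover have "card (F r) \<le> card (F v) + \<delta> \<and> card (F v) \<le> card (F r) + \<delta>" if "v \<in> V" for v
    using card_fibre_diff_le_cut[OF r(1) that] card_fibre_diff_le_cut[OF that r(1)] assms(2) by linarith
  ultimately have "\<pi> \<in> balanced_cut n (card (F r))"
    unfolding balanced_cut_def using fibre by blast
  moreover have "card (F r) \<in> {10 * \<delta>..n div 2}" using True r(2) by simp
  ultimately show ?thesis by blast
next
  case False
  let ?S = "Sigma V F"
  have "card (F v) \<le> 11 * \<delta>" if "v \<in> V" for v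
    using card_fibre_diff_le_cut[OF r(1) that] assms(2) False by linarith
  then have "(\<Sum>v\<in>V. card (F v)) \<le> (\<Sum>v\<in>V. 11 * \<delta>)" by (rule sum_mono)
  moreover have "card ?S = (\<Sum>v\<in>V. card (F v))"
    using finite_V finite_fibre by (intro card_SigmaI) auto
  ultimately have "card ?S \<le> 11 * \<delta> * card V" by (simp add: mult_ac)
  moreover have "1 \<le> card ?S" using assms(1) finite_total by (simp add: Suc_leI card_gt_0_iff)
  moreover have "\<pi> \<in> dense_part n (card ?S)"
  proof -
    obtain M where M: "M \<subseteq> inner_arcs F \<pi>" "card M = 2 * card ?S"
      using card_inner_arcs_ge[OF assms(1,2)] by (meson obtain_subset_with_card_n)
    have "M \<subseteq> ?S \<times> ?S" using M(1) inner_arcs_subset by (rule subset_trans)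
    moreover have "M \<subseteq> {((x, i), (y, j)). (x, y) \<in> D}" "\<forall>((x, i), (y, j))\<in>M. \<pi> (x, y) i = j"
      using M(1) by (auto simp: inner_arcs_def)
    moreover have "?S \<subseteq> V \<times> {1..n}" using fibre by blast
    ultimately show ?thesis unfolding dense_part_def using M(2) by blast
  qed
  ultimately show ?thesis by (intro UnI1 UN_I[of "card ?S"]) auto
qed

end

context lift_base
begin

definition fibres :: "('a \<times> nat) set \<Rightarrow> 'a \<Rightarrow> nat set" where
  "fibres S v = {i. (v, i) \<in> S}"

definition small_cut :: "nat \<Rightarrow> ('a \<times> 'a \<Rightarrow> nat \<Rightarrow> nat) set" where
  "small_cut n = {\<pi>. \<exists>S. S \<noteq> {} \<and> S \<subset> V \<times> {1..n} \<and> cut n (fibres S) \<pi> < \<delta>}"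

text \<open>Either the set or its complement fills at most half of the fibre over \<open>r\<close>.
  Both are nonempty and have the same cut.\<close>

lemma small_cut_subset:
  assumes perm: "\<And>e. e \<in> D \<Longrightarrow> \<pi> e permutes {1..n}" and "\<pi> \<in> small_cut n"
  shows "\<pi> \<in> (\<Union>s\<in>{1..11 * \<delta> * card V}. dense_part n s)
           \<union> (\<Union>a\<in>{10 * \<delta>..n div 2}. balanced_cut n a)"
proof -
  obtain S where S: "S \<noteq> {}" "S \<subset> V \<times> {1..n}" "cut n (fibres S) \<pi> < \<delta>"
    using assms(2) unfolding small_cut_def by blast
  obtain r where r: "r \<in> V" using V_nonempty by blast
  let ?F = "fibres S" and ?F' = "\<lambda>v. {1..n} - fibres S v"
  interpret c: lift_cut V D \<delta> n \<pi> ?F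
    by unfold_locales (use perm S(2) in \<open>auto simp: fibres_def\<close>)
  interpret c': lift_cut V D \<delta> n \<pi> ?F'
    by unfold_locales (use perm in auto)
  show ?thesis
  proof (cases "2 * card (?F r) \<le> n")
    case True
    have "Sigma V ?F \<noteq> {}" using S(1,2) unfolding fibres_def by blast
    then show ?thesis using c.small_cut_cases[OF _ S(3) r True] by blast
  next
    case False
    have "card (?F' r) = n - card (?F r)" using c.fibre[OF r] c.finite_fibre[OF r]
      by (simp add: card_Diff_subset)
    then have "2 * card (?F' r) \<le> n" using False by linarith
    moreover have "Sigma V ?F' \<noteq> {}" using S(2) unfolding fibres_def by blast
    moreover have "cut n ?F' \<pi> < \<delta>" using S(3) c.cut_complement by simp
    ultimately show ?thesis using c'.small_cut_cases[OF _ _ r] by blast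
  qed
qed

text \<open>The two union bounds combined and expressed through the single parameter \<delta> k, the
  quantity that the growth hypothesis controls.\<close>

lemma prob_small_cut:
  assumes n: "200 * (\<delta> * card V)\<^sup>2 \<le> n"
  shows "measure_pmf.prob (perms n) (small_cut n)
           \<le> 4 * 11 ^ 5 * (real (\<delta> * card V)) ^ 6 / real n + 1 / real (Suc n)"
proof -
  let ?w = "\<delta> * card V"
  have k: "1 \<le> card V" using V_nonempty finite_V by (simp add: Suc_leI card_gt_0_iff)
  have \<delta>w: "\<delta> \<le> ?w" using k by simp
  have w: "5 \<le> ?w" using \<delta>w \<delta>_ge by linarith
  have "200 * (?w * ?w) \<le> n" using n by (simp only: power2_eq_square)
  then have wn: "200 * ?w \<le> n" using le_square[of ?w] by linarith
  then have t: "4 * (11 * \<delta> * card V) \<le> n" by (simp add: mult.assoc)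
  have n0: "0 < n" using w wn by linarith
  have n': "200 * \<delta>\<^sup>2 \<le> n" using n power_mono[OF \<delta>w, of 2] by linarith
  let ?A = "\<Union>s\<in>{1..11 * \<delta> * card V}. dense_part n s"
  let ?B = "\<Union>a\<in>{10 * \<delta>..n div 2}. balanced_cut n a"
  have "measure_pmf.prob (perms n) (small_cut n) \<le> measure_pmf.prob (perms n) (?A \<union> ?B)"
  proof (rule measure_pmf.finite_measure_mono_AE)
    show "AE \<pi> in perms n. \<pi> \<in> small_cut n \<longrightarrow> \<pi> \<in> ?A \<union> ?B"
    proof (rule AE_pmfI, rule impI)
      fix \<pi> assume \<pi>: "\<pi> \<in> set_pmf (perms n)" "\<pi> \<in> small_cut n"
      show "\<pi> \<in> ?A \<union> ?B" using set_pmf_perms[OF \<pi>(1)] \<pi>(2) by (rule small_cut_subset)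
    qed
  qed simp
  also have "\<dots> \<le> measure_pmf.prob (perms n) ?A + measure_pmf.prob (perms n) ?B"
    by (rule measure_Un_le) auto
  also have "\<dots> \<le> 4 * real (card V) * real (11 * \<delta> * card V) ^ 5 / real n + 1 / real (Suc n)"
    using t n0 n' by (intro add_mono prob_UN_dense_part prob_UN_balanced_cut)
  \<comment> \<open>Enlarging \<open>card V\<close> to \<open>?w\<close> yields the sixth power of
    \<open>?w\<close>.\<close>
  also have "4 * real (card V) * real (11 * \<delta> * card V) ^ 5 / real n
      \<le> 4 * real ?w * real (11 * \<delta> * card V) ^ 5 / real n"
    using \<delta>_ge by (intro divide_right_mono mult_right_mono mult_left_mono of_nat_mono) auto
  also have "\<dots> = 4 * 11 ^ 5 * (real ?w) ^ 6 / real n"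
    by (simp add: power_mult_distrib power_numeral_reduce mult_ac)
  finally show ?thesis by simp
qed

end

section \<open>Translation to the graph-theoretic definitions\<close>

lemma card_doubleton_Int_eq_1:
  assumes "x \<noteq> y"
  shows "card ({x, y} \<inter> S) = 1 \<longleftrightarrow> (x \<in> S) \<noteq> (y \<in> S)"
  using assms by (cases "x \<in> S"; cases "y \<in> S") (auto simp: Int_insert_left)

text \<open>An arc leaving \<open>v\<close> is either an arc of \<open>D\<close> with tail
  \<open>v\<close> or the reverse of one with head \<open>v\<close>, which gives the degree bound. A
  set crossed by no arc of \<open>D\<close> is closed under reachability, so connectedness supplies
  crossing arcs.\<close>

lemma orientation_lift_base:
  assumes G: "pair_graph G" and conn: "Digraph_Component.connected (with_proj G)"
    and D: "orientation G D" and \<delta>: "min_degree G = \<delta>" "5 \<le> \<delta>"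
  shows "lift_base (pverts G) D \<delta>"
proof -
  interpret pair_graph G by fact
  have DG: "D \<union> D\<inverse> = parcs G" "D \<inter> D\<inverse> = {}" using D by (auto simp: orientation_def)
  have finD: "finite D" using DG(1) pair_finite_arcs by (metis finite_Un)
  have ne: "pverts G \<noteq> {}"
    using conn unfolding Digraph_Component.connected_def strongly_connected_def by simp
  show ?thesis
  proof
    show "finite (pverts G)" by (rule pair_finite_verts)
    show "pverts G \<noteq> {}" by (rule ne)
    show "D \<subseteq> pverts G \<times> pverts G" using DG(1) wellformed' by fast
    show "D \<inter> D\<inverse> = {}" by fact
    show "5 \<le> \<delta>" by fact
    show "\<delta> \<le> card {e \<in> D. fst e = v} + card {e \<in> D. snd e = v}" if "v \<in> pverts G" for v
    proof -
      have "\<delta> \<le> card (out_arcs (with_proj G) v)"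
        using that pair_finite_verts unfolding \<delta>(1)[symmetric] min_degree_def out_degree_def[symmetric]
        by (intro Min_le) auto
      also have "out_arcs (with_proj G) v = {e \<in> D. fst e = v} \<union> {e \<in> D. snd e = v}\<inverse>"
        unfolding out_arcs_def with_proj_simps DG(1)[symmetric] by force
      also have "card \<dots> \<le> card {e \<in> D. fst e = v} + card {e \<in> D. snd e = v}"
        using card_Un_le[of "{e \<in> D. fst e = v}" "{e \<in> D. snd e = v}\<inverse>"] by (simp only: card_inverse)
      finally show ?thesis .
    qed
    show "\<exists>(x, y)\<in>D. (x \<in> W) \<noteq> (y \<in> W)" if W: "W \<subseteq> pverts G" "W \<noteq> {}" "W \<noteq> pverts G" for W
    proof (rule ccontr)
      assume no: "\<not> ?thesis"
      have step: "x \<in> W \<Longrightarrow> y \<in> W" if "(x, y) \<in> parcs (mk_symmetric (with_proj G))" for x y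
      proof -
        have "(x, y) \<in> D \<or> (y, x) \<in> D"
          using that unfolding parcs_mk_symmetric with_proj_simps DG(1)[symmetric] by auto
        then show "x \<in> W \<Longrightarrow> y \<in> W" using no by blast
      qed
      obtain u v where uv: "u \<in> W" "v \<in> pverts G" "v \<notin> W" using W by blast
      have "(u, v) \<in> rtrancl_on (pverts G) (parcs (mk_symmetric (with_proj G)))"
        using conn uv W(1)
        unfolding Digraph_Component.connected_def strongly_connected_def reachable_def with_proj_simps
          pverts_mk_symmetric by blast
      then have "v \<in> W" using uv(1)
        by (induction rule: rtrancl_on_induct) (auto dest: step)
      then show False using uv(3) by blast
    qed
  qed
qed

context lift_cut
begin

lemma card_crossing_arcs:
  "card {((x, i), (y, j)) | x i y j. (x, y) \<in> D \<and> i \<in> {1..n} \<and> j = \<pi> (x, y) i \<and> (i \<in> F x) \<noteq> (j \<in> F y)}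
    = cut n F \<pi>"
proof -
  let ?f = "\<lambda>(e, i). ((fst e, i), (snd e, \<pi> e i))"
  let ?K = "Sigma D (\<lambda>e. discrepancy n (F (fst e)) (F (snd e)) (\<pi> e))"
  have "{((x, i), (y, j)) | x i y j. (x, y) \<in> D \<and> i \<in> {1..n} \<and> j = \<pi> (x, y) i \<and> (i \<in> F x) \<noteq> (j \<in> F y)}
        = ?f ` ?K"
    unfolding discrepancy_def by (force simp: image_iff)
  moreover have "inj_on ?f ?K" by (auto intro!: inj_onI simp: prod_eq_iff)
  ultimately have "card {((x, i), (y, j)) | x i y j.
      (x, y) \<in> D \<and> i \<in> {1..n} \<and> j = \<pi> (x, y) i \<and> (i \<in> F x) \<noteq> (j \<in> F y)} = card ?K"
    by (simp only: card_image)
  also have "\<dots> = cut n F \<pi>"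
    unfolding cut_def using finite_D by (intro card_SigmaI) (auto simp: discrepancy_def)
  finally show ?thesis .
qed

end

context lift_base
begin

text \<open>Each crossing arc is sent to its underlying unordered pair. This is injective because
  \<open>D\<close> never contains an arc together with its reverse.\<close>

lemma cut_fibres_le_card_uedges:
  assumes perm: "\<And>e. e \<in> D \<Longrightarrow> \<pi> e permutes {1..n}" and S: "S \<subset> V \<times> {1..n}"
    and V: "pverts G = V"
  shows "cut n (fibres S) \<pi> \<le> card {e \<in> uedges (lift_graph n G D \<pi>). card (e \<inter> S) = 1}"
proof -
  interpret c: lift_cut V D \<delta> n \<pi> "fibres S"
    by unfold_locales (use perm S in \<open>auto simp: fibres_def\<close>)
  let ?X = "{((x, i), (y, j)) | x i y j.
    (x, y) \<in> D \<and> i \<in> {1..n} \<and> j = \<pi> (x, y) i \<and> (i \<in> fibres S x) \<noteq> (j \<in> fibres S y)}"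
  let ?U = "uedges (lift_graph n G D \<pi>)"
  have L: "((x, i), (y, j)) \<in> lift_arcs n D \<pi> \<and> ((x, i) \<in> S) \<noteq> ((y, j) \<in> S) \<and> (x, y) \<in> D"
    if "((x, i), (y, j)) \<in> ?X" for x i y j
  proof -
    have *: "(x, y) \<in> D" "i \<in> {1..n}" "j = \<pi> (x, y) i" "(i \<in> fibres S x) \<noteq> (j \<in> fibres S y)"
      using that by auto
    moreover have "j \<in> {1..n}" using permutes_in_image[OF perm[OF *(1)], of i] *(2,3) by blast
    ultimately show ?thesis unfolding lift_arcs_def fibres_def by blast
  qed
  have "card ?X \<le> card {e \<in> ?U. card (e \<inter> S) = 1}"
  proof (rule card_inj_on_le[where f = "\<lambda>(p, q). {p, q}"])
    show "inj_on (\<lambda>(p, q). {p, q}) ?X"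
    proof (rule inj_onI)
      fix a b assume ab: "a \<in> ?X" "b \<in> ?X" "(\<lambda>(p, q). {p, q}) a = (\<lambda>(p, q). {p, q}) b"
      obtain x i y j where a: "a = ((x, i), (y, j))" by (metis surj_pair)
      obtain x' i' y' j' where b: "b = ((x', i'), (y', j'))" by (metis surj_pair)
      have "(x, y) \<in> D" "(x', y') \<in> D" using ab(1,2) unfolding a b by blast+
      then have "\<not> (x = y' \<and> y = x')" using D_antisym by blast
      then show "a = b" using ab(3) unfolding a b by (auto simp: doubleton_eq_iff)
    qed
    show "(\<lambda>(p, q). {p, q}) ` ?X \<subseteq> {e \<in> ?U. card (e \<inter> S) = 1}"
    proof (rule image_subsetI)
      fix a assume a: "a \<in> ?X"
      obtain x i y j where axy: "a = ((x, i), (y, j))" by (metis surj_pair)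
      note l = L[of x i y j]
      have "((x, i), (y, j)) \<in> lift_arcs n D \<pi>" "((x, i) \<in> S) \<noteq> ((y, j) \<in> S)"
        using l a unfolding axy by blast+
      moreover from this have "{(x, i), (y, j)} \<in> ?U" unfolding uedges_def lift_graph_def by auto
      moreover have "(x, i) \<noteq> (y, j)" using calculation(2) by auto
      ultimately have "{(x, i), (y, j)} \<in> {e \<in> ?U. card (e \<inter> S) = 1}"
        using card_doubleton_Int_eq_1[of "(x, i)" "(y, j)" S] by blast
      then show "(\<lambda>(p, q). {p, q}) a \<in> {e \<in> ?U. card (e \<inter> S) = 1}"
        unfolding axy by (simp only: prod.case)
    qed
    have "?U \<subseteq> Pow (V \<times> {1..n})"
      using D_subset unfolding uedges_def lift_graph_def lift_arcs_def by auto
    then show "finite {e \<in> ?U. card (e \<inter> S) = 1}"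
      using finite_V by (auto intro: finite_subset)
  qed
  then show ?thesis unfolding c.card_crossing_arcs .
qed

text \<open>A lift that is not \<delta>-edge-connected has a vertex set with fewer than \<delta>
  boundary edges, hence almost surely lies in \<open>small_cut\<close>.\<close>

lemma prob_edge_connected_ge:
  assumes n: "200 * (\<delta> * card V)\<^sup>2 \<le> n" and V: "pverts G = V"
  shows "1 - (4 * 11 ^ 5 * (real (\<delta> * card V)) ^ 6 / real n + 1 / real (Suc n))
    \<le> measure_pmf.prob (random_lift n G D) {H. edge_connected \<delta> H}"
proof -
  let ?E = "lift_graph n G D -` {H. edge_connected \<delta> H}"
  have "1 - measure_pmf.prob (perms n) ?E = measure_pmf.prob (perms n) (- ?E)"
    using measure_pmf.prob_compl[of ?E "perms n"] by (simp add: Compl_eq_Diff_UNIV)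
  also have "\<dots> \<le> measure_pmf.prob (perms n) (small_cut n)"
  proof (rule measure_pmf.finite_measure_mono_AE)
    show "AE \<pi> in perms n. \<pi> \<in> - ?E \<longrightarrow> \<pi> \<in> small_cut n"
    proof (rule AE_pmfI, rule impI)
      fix \<pi> assume \<pi>: "\<pi> \<in> set_pmf (perms n)" "\<pi> \<in> - ?E"
      have "\<not> edge_connected \<delta> (lift_graph n G D \<pi>)" using \<pi>(2) by simp
      then obtain S where S: "S \<noteq> {}" "S \<subset> V \<times> {1..n}"
        "card {e \<in> uedges (lift_graph n G D \<pi>). card (e \<inter> S) = 1} < \<delta>"
        unfolding edge_connected_def by (auto simp: lift_graph_def V not_le)
      then have "cut n (fibres S) \<pi> < \<delta>" using cut_fibres_le_card_uedges[of \<pi>, OF set_pmf_perms[OF \<pi>(1)] S(2) V] by linarith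
      then show "\<pi> \<in> small_cut n" unfolding small_cut_def using S by blast
    qed
  qed simp
  also have "\<dots> \<le> 4 * 11 ^ 5 * (real (\<delta> * card V)) ^ 6 / real n + 1 / real (Suc n)"
    using n by (rule prob_small_cut)
  finally have "1 - (4 * 11 ^ 5 * (real (\<delta> * card V)) ^ 6 / real n + 1 / real (Suc n))
    \<le> measure_pmf.prob (perms n) ?E" by linarith
  then show ?thesis unfolding random_lift_def perms_def by (simp only: measure_map_pmf)
qed

end

theorem theorem4p10:
  shows "\<exists>\<gamma>' > (0::real).
    \<forall>(\<delta> :: nat \<Rightarrow> nat \<Rightarrow> nat) (C :: real) (k :: nat \<Rightarrow> nat)
     (G :: nat \<Rightarrow> 'a pair_pre_digraph) (D :: nat \<Rightarrow> 'a rel).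
      (\<forall>n\<ge>1. 5 \<le> \<delta> n (k n) \<and> real (\<delta> n (k n)) \<le> C * (real n powr \<gamma>' / real (k n))) \<longrightarrow>
      (\<forall>n\<ge>1. pair_graph (G n) \<and> Digraph_Component.connected (with_proj (G n)) \<and>
             card (pverts (G n)) = k n \<and> min_degree (G n) = \<delta> n (k n)) \<longrightarrow>
      (\<forall>n\<ge>1. orientation (G n) (D n)) \<longrightarrow>
      (\<lambda>n. measure_pmf.prob (random_lift n (G n) (D n)) {H. edge_connected (\<delta> n (k n)) H})
        \<longlonglongrightarrow> 1"
\<comment> \<open>The error is of order w^6 / n with w = \<delta> k at most C n^\<gamma>', so any
  exponent below 1/6 suffices; 1/10 also makes w^2 small against n.\<close>
proof (intro exI[of _ "1 / 10"] conjI allI impI)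
  fix \<delta> :: "nat \<Rightarrow> nat \<Rightarrow> nat" and C :: real and k :: "nat \<Rightarrow> nat"
    and G :: "nat \<Rightarrow> 'a pair_pre_digraph" and D :: "nat \<Rightarrow> 'a rel"
  assume \<delta>: "\<forall>n\<ge>1. 5 \<le> \<delta> n (k n) \<and> real (\<delta> n (k n)) \<le> C * (real n powr (1 / 10) / real (k n))"
    and G: "\<forall>n\<ge>1. pair_graph (G n) \<and> Digraph_Component.connected (with_proj (G n)) \<and>
             card (pverts (G n)) = k n \<and> min_degree (G n) = \<delta> n (k n)"
    and D: "\<forall>n\<ge>1. orientation (G n) (D n)"
  let ?p = "\<lambda>n. measure_pmf.prob (random_lift n (G n) (D n)) {H. edge_connected (\<delta> n (k n)) H}"
  let ?b = "\<lambda>n. C * real n powr (1 / 10)"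
  let ?q = "\<lambda>n. 1 - (4 * 11 ^ 5 * ?b n ^ 6 / real n + 1 / real (Suc n))"
  \<comment> \<open>The hypothesis at n = 1 bounds a number that is at least 5, so C cannot be
    nonpositive.\<close>
  have C_pos: "0 < C"
  proof (rule ccontr)
    assume "\<not> 0 < C"
    then have "C * (real 1 powr (1 / 10) / real (k 1)) \<le> 0" by (simp add: divide_nonpos_nonneg)
    then show False using \<delta>[rule_format, of 1] by linarith
  qed
  then have "eventually (\<lambda>n. 200 * (?b n)\<^sup>2 \<le> real n) sequentially"
    by real_asymp
  then have "eventually (\<lambda>n. ?q n \<le> ?p n) sequentially"
    using eventually_ge_at_top[of 1]
  proof eventually_elim
    case (elim n)
    interpret lift_base "pverts (G n)" "D n" "\<delta> n (k n)"
      using orientation_lift_base elim(2) G D \<delta> by blast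
    have cV: "card (pverts (G n)) = k n" using G elim(2) by blast
    have "0 < k n" using V_nonempty finite_V cV by (metis card_gt_0_iff)
    moreover have "real (\<delta> n (k n)) \<le> ?b n / real (k n)" using \<delta> elim(2) by simp
    ultimately have w: "real (\<delta> n (k n) * k n) \<le> ?b n" by (simp add: field_simps)
    have "200 * (real (\<delta> n (k n) * k n))\<^sup>2 \<le> 200 * (?b n)\<^sup>2"
      using w by (intro mult_left_mono power_mono) auto
    also have "\<dots> \<le> real n" by (rule elim(1))
    finally have "real (200 * (\<delta> n (k n) * k n)\<^sup>2) \<le> real n" by (simp only: of_nat_mult of_nat_power of_nat_numeral)
    then have "200 * (\<delta> n (k n) * k n)\<^sup>2 \<le> n" by (simp only: of_nat_le_iff)
    then have "1 - (4 * 11 ^ 5 * (real (\<delta> n (k n) * k n)) ^ 6 / real n + 1 / real (Suc n)) \<le> ?p n"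
      using prob_edge_connected_ge[of n "G n"] by (simp only: cV)
    moreover have "4 * 11 ^ 5 * (real (\<delta> n (k n) * k n)) ^ 6 / real n \<le> 4 * 11 ^ 5 * ?b n ^ 6 / real n"
      using w by (intro divide_right_mono mult_left_mono power_mono) auto
    ultimately show ?case by linarith
  qed
  moreover have "eventually (\<lambda>n. ?p n \<le> 1) sequentially" by simp
  moreover have "?q \<longlonglongrightarrow> 1" using C_pos by real_asymp
  ultimately show "?p \<longlonglongrightarrow> 1" by (rule tendsto_sandwich[OF _ _ _ tendsto_const])
qed simp

end
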